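(* Let the matrices $V^{(1)}\in\mathbb{R}^{n\times\ell_1}$ and $V^{(2)}\in\mathbb{R}^{n\times\ell_2}$ have orthonormal columns, and let $\mathcal{B}$ denote the set of matrices of the form $B=B^{(2)}\otimes B^{(1)}$, where $B^{(i)}\in\mathbb{R}^{n\times n}$ and the null space of $B^{(i)}$ contains $\mathcal{R}(V^{(i)})$ for $i=1,2$. For $i=1,2$ let $P^{(i)}=I-V^{(i)}V^{(i)T}$ be the orthogonal projector with null space $\mathcal{R}(V^{(i)})$, and let $P=P^{(2)}\otimes P^{(1)}$. Let $A=A^{(2)}\otimes A^{(1)}$ with $A^{(i)}\in\mathbb{R}^{n\times n}$, $i=1,2$. Then the matrix $\widehat{A}=AP$ is a closest matrix to $A$ in $\mathcal{B}$ in the Frobenius norm; that is, $\widehat{A}\in\mathcal{B}$ and $\|A-\widehat{A}\|_F\le\|A-B\|_F$ for all $B\in\mathcal{B}$.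
   Context: $\otimes$ denotes the Kronecker product of matrices, $\mathcal{R}(M)$ denotes the range (column space) of the matrix $M$, the superscript $^T$ denotes transposition, $I$ is the $n\times n$ identity matrix, and $\|M\|_F=\sqrt{\mathrm{trace}(M^TM)}$ is the Frobenius norm. *)

theory Defs
  imports "HOL-Analysis.Analysis"
begin

text \<open>
  The rows and columns of a Kronecker product are indexed by pairs: the first component selects the
  block (an entry of \<open>A\<close>), the second the position inside the block (an entry of \<open>B\<close>). The
  lexicographic enumeration of the pairs gives the usual block matrix of size \<open>n\<^sup>2 \<times> n\<^sup>2\<close>.
\<close>

definition kronecker ::
    "real^'b^'a \<Rightarrow> real^'d^'c \<Rightarrow> real^('b \<times> 'd)^('a \<times> 'c)"  (infixr "\<otimes>\<^sub>K" 72)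
  where "A \<otimes>\<^sub>K B = (\<chi> i j. A $ fst i $ fst j * B $ snd i $ snd j)"

definition frobenius_norm :: "real^'m^'n \<Rightarrow> real"
  where "frobenius_norm M = sqrt (trace (transpose M ** M))"

definition orthonormal_columns :: "real^'l^'n \<Rightarrow> bool"
  where "orthonormal_columns V \<longleftrightarrow>
    (\<forall>i j. column i V \<bullet> column j V = (if i = j then 1 else 0))"

definition matrix_range :: "real^'l^'n \<Rightarrow> (real^'n) set"
  where "matrix_range M = range (\<lambda>x. M *v x)"

definition null_space :: "real^'m^'n \<Rightarrow> (real^'m) set"
  where "null_space M = {x. M *v x = 0}"

definition complement_projector :: "real^'l^'n \<Rightarrow> real^'n^'n"
  where "complement_projector V = mat 1 - V ** transpose V"

definition kronecker_annihilators ::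
    "real^'l1^'n \<Rightarrow> real^'l2^'n \<Rightarrow> (real^('n \<times> 'n)^('n \<times> 'n)) set"
  where "kronecker_annihilators V1 V2 =
    {B2 \<otimes>\<^sub>K B1 | (B1 :: real^'n^'n) (B2 :: real^'n^'n).
      matrix_range V1 \<subseteq> null_space B1 \<and> matrix_range V2 \<subseteq> null_space B2}"

end

theory Submission
  imports Defs
begin

text \<open>
  The matrix \<open>P\<close> is symmetric and idempotent, and every \<open>B\<close> in the admissible set satisfies
  \<open>B P = B\<close>. Hence, with \<open>D = A - B\<close>, the error is \<open>A - A P = D - D P\<close>. Since right multiplication
  by \<open>P\<close> is an orthogonal projection for the Frobenius inner product, the norm of \<open>D - D P\<close> is at
  most that of \<open>D\<close>. The Kronecker structure enters only through the mixed-product rule, which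
  shows that \<open>A P\<close> is itself a Kronecker product.
\<close>

text \<open>A product of two sums is a sum over pairs, and pairs are exactly the inner index of a
  product of Kronecker matrices.\<close>

lemma kronecker_mult:
  "(A \<otimes>\<^sub>K B) ** (C \<otimes>\<^sub>K D) = (A ** C) \<otimes>\<^sub>K (B ** D)"
  by (simp add: kronecker_def matrix_matrix_mult_def vec_eq_iff sum_product
      sum.cartesian_product mult_ac split_beta flip: UNIV_Times_UNIV)

lemma transpose_kronecker:
  "transpose (A \<otimes>\<^sub>K B) = transpose A \<otimes>\<^sub>K transpose B"
  by (simp add: kronecker_def transpose_def vec_eq_iff)

text \<open>Gives access to the inner product of the type \<open>real^'m^'n\<close>: the trace sums
  the squared entries column by column, the inner product row by row.\<close>

lemma frobenius_norm_eq_norm: "frobenius_norm M = norm M"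
proof -
  have "trace (transpose M ** M) = M \<bullet> M"
    unfolding trace_def matrix_matrix_mult_def transpose_def inner_vec_def
    by (subst sum.swap) simp
  then show ?thesis
    by (simp add: frobenius_norm_def norm_eq_sqrt_inner)
qed

lemma transpose_diff: "transpose (A - B) = transpose A - transpose (B :: 'a::ab_group_add^'n^'m)"
  by (simp add: transpose_def vec_eq_iff)

lemma matrix_diff_ldistrib: "A ** (B - C) = A ** B - A ** (C :: 'a::ring_1^'n^'m)"
  by (simp add: matrix_matrix_mult_def vec_eq_iff right_diff_distrib sum_subtractf)

lemma matrix_diff_rdistrib: "(A - B) ** C = A ** C - (B :: 'a::ring_1^'n^'m) ** C"
  by (simp add: matrix_matrix_mult_def vec_eq_iff left_diff_distrib sum_subtractf)

text \<open>Right multiplication acts on each row separately, so the adjoint rule for vectors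
  applies row by row.\<close>

lemma inner_matrix_mult_left:
  fixes X :: "real^'m^'n" and P :: "real^'k^'m"
  shows "(X ** P) \<bullet> Y = X \<bullet> (Y ** transpose P)"
proof -
  have row: "(M ** N) $ i = M $ i v* N" for M :: "real^'b^'a" and N :: "real^'c^'b" and i
    by (simp add: matrix_matrix_mult_def vector_matrix_mult_def vec_eq_iff mult.commute)
  show ?thesis
    by (simp add: inner_vec_def[where 'b = 'n] row dot_lmul_matrix)
qed

lemma frobenius_norm_diff_projection_le:
  fixes A B :: "real^'m^'n"
  assumes "transpose P = P" "P ** P = P" "B ** P = B"
  shows "frobenius_norm (A - A ** P) \<le> frobenius_norm (A - B)"
proof -
  define D where "D = A - B"
  have "A - A ** P = D - D ** P"
    by (simp add: D_def matrix_diff_rdistrib assms)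
  \<comment> \<open>Symmetry lets one factor \<open>P\<close> move across the inner product, where
    idempotence absorbs it. The next equation is then Pythagoras.\<close>
  moreover have "(D ** P) \<bullet> (D ** P) = D \<bullet> (D ** P)"
    by (simp add: inner_matrix_mult_left assms flip: matrix_mul_assoc)
  then have "(D - D ** P) \<bullet> (D - D ** P) = D \<bullet> D - (D ** P) \<bullet> (D ** P)"
    by (simp add: inner_diff inner_commute)
  ultimately show ?thesis
    by (simp add: frobenius_norm_eq_norm norm_eq_sqrt_inner flip: D_def)
qed

lemma orthonormal_columns_iff: "orthonormal_columns V \<longleftrightarrow> transpose V ** V = mat 1"
  by (simp add: orthonormal_columns_def matrix_matrix_mult_def mat_def transpose_def column_def
      inner_vec_def vec_eq_iff)

text \<open>Turns membership in the admissible set into matrix equations, so that the rest is pure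
  matrix algebra.\<close>

lemma matrix_range_subset_null_space_iff:
  "matrix_range V \<subseteq> null_space B \<longleftrightarrow> B ** V = 0"
  by (simp add: matrix_range_def null_space_def image_subset_iff matrix_vector_mul_assoc matrix_eq)

lemma transpose_complement_projector:
  "transpose (complement_projector V) = complement_projector V"
  by (simp add: complement_projector_def transpose_diff matrix_transpose_mul)

lemma complement_projector_mult_self:
  assumes "orthonormal_columns V"
  shows "complement_projector V ** V = 0"
  using assms
  by (simp add: complement_projector_def matrix_diff_rdistrib orthonormal_columns_iff
      flip: matrix_mul_assoc)

lemma mult_complement_projector:
  assumes "B ** V = 0"
  shows "B ** complement_projector V = B"
  using assms by (simp add: complement_projector_def matrix_diff_ldistrib matrix_mul_assoc)

theorem proposition2p1:
  fixes V1 :: "real^'l1^'n" and V2 :: "real^'l2^'n"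
    and A1 A2 :: "real^'n^'n"
    and A P Ahat :: "real^('n \<times> 'n)^('n \<times> 'n)"
  assumes "orthonormal_columns V1" and "orthonormal_columns V2"
    and "P = complement_projector V2 \<otimes>\<^sub>K complement_projector V1"
    and "A = A2 \<otimes>\<^sub>K A1"
    and "Ahat = A ** P"
  shows "Ahat \<in> kronecker_annihilators V1 V2 \<and>
    (\<forall>B \<in> kronecker_annihilators V1 V2.
      frobenius_norm (A - Ahat) \<le> frobenius_norm (A - B))"
proof (intro conjI ballI)
  note projector_mult =
    complement_projector_mult_self[OF assms(1)] complement_projector_mult_self[OF assms(2)]
  have "Ahat = (A2 ** complement_projector V2) \<otimes>\<^sub>K (A1 ** complement_projector V1)"
    by (simp add: assms kronecker_mult)
  moreover have "A1 ** complement_projector V1 ** V1 = 0" "A2 ** complement_projector V2 ** V2 = 0"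
    by (simp_all add: projector_mult flip: matrix_mul_assoc)
  ultimately show "Ahat \<in> kronecker_annihilators V1 V2"
    unfolding kronecker_annihilators_def matrix_range_subset_null_space_iff by blast
  fix B assume "B \<in> kronecker_annihilators V1 V2"
  then obtain B1 B2 where "B = B2 \<otimes>\<^sub>K B1" "B1 ** V1 = 0" "B2 ** V2 = 0"
    unfolding kronecker_annihilators_def matrix_range_subset_null_space_iff by blast
  then have "B ** P = B"
    by (simp add: assms kronecker_mult mult_complement_projector)
  \<comment> \<open>Idempotence is the absorption rule \<open>mult_complement_projector\<close> with
    each projector in the role of \<open>B\<close>, since it annihilates its own \<open>V1\<close>
    or \<open>V2\<close>.\<close>
  moreover have "transpose P = P" "P ** P = P"
    by (simp_all add: assms kronecker_mult transpose_kronecker transpose_complement_projector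
        mult_complement_projector projector_mult)
  ultimately show "frobenius_norm (A - Ahat) \<le> frobenius_norm (A - B)"
    unfolding assms(5) by (intro frobenius_norm_diff_projection_le)
qed

end
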